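(* Let $n \ge 3$ and let $D_{2n} = \langle x, y \mid x^2 = 1,\ y^n = 1,\ yx = xy^{-1}\rangle$ be the dihedral group of order $2n$. Let $S$ be a sequence of $n$ elements of $D_{2n}$. \begin{enumerate} \item If $n \ge 4$, then the following are equivalent: (i) $S$ is free of product-$1$ subsequences; (ii) there exist integers $t$ with $1 \le t \le n-1$ and $\gcd(t,n)=1$, and $s$ with $0 \le s \le n-1$, such that $S = (y^t, y^t, \dots, y^t, xy^s)$, where $y^t$ appears exactly $n-1$ times. \item If $n = 3$, then $S$ is free of product-$1$ subsequences if and only if either $S = (y^t, y^t, xy^{\nu})$ for some $t \in \{1,2\}$ and $\nu \in \{0,1,2\}$, or $S = (x, xy, xy^2)$. \end{enumerate}
   Context: A sequence in a finite group $G$ is a finite list $(g_1,\dots,g_l)$ of elements of $G$ with repetitions allowed; sequences are considered up to reordering of their terms. A subsequence is obtained by choosing a subset of the index set $\{1,\dots,l\}$. A non-empty subsequence $(g_{n_1},\dots,g_{n_k})$ is a product-$1$ subsequence if $g_{\sigma(n_1)} g_{\sigma(n_2)} \cdots g_{\sigma(n_k)} = 1$ for some permutation $\sigma$ of $\{n_1,\dots,n_k\}$. A sequence is free of product-$1$ subsequences if it has no non-empty product-$1$ subsequence. *)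

theory Defs
  imports "HOL-Algebra.Algebra" "HOL-Library.Multiset"
begin

section \<open>Groups given by generators and relations\<close>

text \<open>A word is a list of letters; \<open>(g, True)\<close> stands for the generator \<open>g\<close> and
  \<open>(g, False)\<close> for its formal inverse. A relation \<open>u = v\<close> is the pair \<open>(u, v)\<close>.\<close>

type_synonym 'g word = "('g \<times> bool) list"

inductive pres_eq :: "('g word \<times> 'g word) set \<Rightarrow> 'g word \<Rightarrow> 'g word \<Rightarrow> bool" for R where
  pres_refl: "pres_eq R u u"
| pres_sym: "pres_eq R u v \<Longrightarrow> pres_eq R v u"
| pres_trans: "pres_eq R u v \<Longrightarrow> pres_eq R v w \<Longrightarrow> pres_eq R u w"
| pres_append: "pres_eq R u u' \<Longrightarrow> pres_eq R v v' \<Longrightarrow> pres_eq R (u @ v) (u' @ v')"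
| pres_cancel: "pres_eq R [(g, b), (g, \<not> b)] []"
| pres_rel: "(u, v) \<in> R \<Longrightarrow> pres_eq R u v"

definition word_class :: "('g word \<times> 'g word) set \<Rightarrow> 'g word \<Rightarrow> 'g word set" where
  "word_class R u = {v. pres_eq R u v}"

definition presented_group :: "('g word \<times> 'g word) set \<Rightarrow> 'g word set monoid" where
  "presented_group R =
     \<lparr>carrier = range (word_class R),
      monoid.mult = (\<lambda>A B. \<Union>u\<in>A. \<Union>v\<in>B. word_class R (u @ v)),
      one = word_class R []\<rparr>"

lemma word_class_eq_iff: "word_class R u = word_class R v \<longleftrightarrow> pres_eq R u v"
  unfolding word_class_def
  by (metis (mono_tags) Collect_cong mem_Collect_eq pres_refl pres_sym pres_trans)

lemma presented_group_mult:
  "word_class R u \<otimes>\<^bsub>presented_group R\<^esub> word_class R v = word_class R (u @ v)"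
proof -
  have "word_class R (u' @ v') = word_class R (u @ v)"
    if "u' \<in> word_class R u" "v' \<in> word_class R v" for u' v'
  proof -
    have "pres_eq R (u @ v) (u' @ v')"
      using that by (simp add: word_class_def pres_append)
    then show ?thesis
      unfolding word_class_eq_iff by (rule pres_sym)
  qed
  moreover have "u \<in> word_class R u" "v \<in> word_class R v"
    by (simp_all add: word_class_def pres_refl)
  ultimately have "(\<Union>u'\<in>word_class R u. \<Union>v'\<in>word_class R v. word_class R (u' @ v')) = word_class R (u @ v)"
    by blast
  then show ?thesis
    by (simp add: presented_group_def)
qed

lemma presented_group_carrier: "carrier (presented_group R) = range (word_class R)"
  by (simp add: presented_group_def)

lemma presented_group_one: "\<one>\<^bsub>presented_group R\<^esub> = word_class R []"
  by (simp add: presented_group_def)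

lemma pres_eq_inverse_word:
  "pres_eq R (rev (map (\<lambda>(g, b). (g, \<not> b)) u) @ u) []"
proof (induction u)
  case Nil
  show ?case by (simp add: pres_refl)
next
  case (Cons a u)
  obtain g b where a: "a = (g, b)" by (cases a)
  let ?i = "rev (map (\<lambda>(g, b). (g, \<not> b)) u)"
  have "pres_eq R ([(g, \<not> b), (g, b)]) []"
    using pres_cancel[of R g "\<not> b"] by simp
  then have "pres_eq R (?i @ ([(g, \<not> b), (g, b)] @ u)) (?i @ ([] @ u))"
    by (intro pres_append pres_refl)
  then have "pres_eq R (?i @ ([(g, \<not> b), (g, b)] @ u)) []"
    using Cons.IH pres_trans by fastforce
  then show ?case by (simp add: a)
qed

lemma group_presented_group: "group (presented_group R)"
proof (rule groupI)
  show "\<exists>y\<in>carrier (presented_group R). y \<otimes>\<^bsub>presented_group R\<^esub> a = \<one>\<^bsub>presented_group R\<^esub>"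
    if a: "a \<in> carrier (presented_group R)" for a
  proof -
    obtain u where "a = word_class R u"
      using a by (auto simp: presented_group_carrier)
    then have "word_class R (rev (map (\<lambda>(g, b). (g, \<not> b)) u)) \<otimes>\<^bsub>presented_group R\<^esub> a
        = \<one>\<^bsub>presented_group R\<^esub>"
      by (simp add: presented_group_mult presented_group_one word_class_eq_iff pres_eq_inverse_word)
    then show ?thesis by (auto simp: presented_group_carrier)
  qed
qed (auto simp: presented_group_carrier presented_group_mult presented_group_one)


section \<open>The dihedral group\<close>

datatype dihedral_gen = Gen_x | Gen_y

text \<open>The relations are \<open>x\<^sup>2 = 1\<close>, \<open>y\<^sup>n = 1\<close> and \<open>y x = x y\<^sup>-\<^sup>1\<close>.\<close>

definition dihedral_rels :: "nat \<Rightarrow> (dihedral_gen word \<times> dihedral_gen word) set" where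
  "dihedral_rels n =
     {([(Gen_x, True), (Gen_x, True)], []),
      (replicate n (Gen_y, True), []),
      ([(Gen_y, True), (Gen_x, True)], [(Gen_x, True), (Gen_y, False)])}"

text \<open>The index \<open>n\<close> is half of the group order.\<close>

definition Dih :: "nat \<Rightarrow> dihedral_gen word set monoid" where
  "Dih n = presented_group (dihedral_rels n)"

definition dih_x :: "nat \<Rightarrow> dihedral_gen word set" where
  "dih_x n = word_class (dihedral_rels n) [(Gen_x, True)]"

definition dih_y :: "nat \<Rightarrow> dihedral_gen word set" where
  "dih_y n = word_class (dihedral_rels n) [(Gen_y, True)]"

lemma group_Dih: "group (Dih n)"
  by (simp add: Dih_def group_presented_group)

lemma dih_x_closed: "dih_x n \<in> carrier (Dih n)"
  and dih_y_closed: "dih_y n \<in> carrier (Dih n)"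
  by (auto simp: Dih_def dih_x_def dih_y_def presented_group_carrier)

lemma dih_y_pow:
  "dih_y n [^]\<^bsub>Dih n\<^esub> k = word_class (dihedral_rels n) (replicate k (Gen_y, True))" for k :: nat
proof (induction k)
  case 0
  show ?case by (simp add: Dih_def presented_group_one)
next
  case (Suc k)
  interpret group "Dih n" by (rule group_Dih)
  have "dih_y n [^]\<^bsub>Dih n\<^esub> Suc k = word_class (dihedral_rels n) (replicate k (Gen_y, True)) \<otimes>\<^bsub>Dih n\<^esub> dih_y n"
    using Suc.IH by simp
  also have "\<dots> = word_class (dihedral_rels n) (replicate k (Gen_y, True) @ [(Gen_y, True)])"
    by (simp only: Dih_def dih_y_def presented_group_mult)
  finally show ?case by (simp add: replicate_append_same)
qed

lemma dih_relations:
  "dih_x n \<otimes>\<^bsub>Dih n\<^esub> dih_x n = \<one>\<^bsub>Dih n\<^esub>"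
  "dih_y n [^]\<^bsub>Dih n\<^esub> n = \<one>\<^bsub>Dih n\<^esub>"
  "dih_y n \<otimes>\<^bsub>Dih n\<^esub> dih_x n = dih_x n \<otimes>\<^bsub>Dih n\<^esub> inv\<^bsub>Dih n\<^esub> dih_y n"
proof -
  interpret group "Dih n" by (rule group_Dih)
  show "dih_x n \<otimes>\<^bsub>Dih n\<^esub> dih_x n = \<one>\<^bsub>Dih n\<^esub>"
    by (simp add: Dih_def dih_x_def presented_group_mult presented_group_one word_class_eq_iff)
      (rule pres_rel, simp add: dihedral_rels_def)
  show "dih_y n [^]\<^bsub>Dih n\<^esub> n = \<one>\<^bsub>Dih n\<^esub>"
    unfolding dih_y_pow
    by (simp add: Dih_def presented_group_one word_class_eq_iff)
      (rule pres_rel, simp add: dihedral_rels_def)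
  have "word_class (dihedral_rels n) [(Gen_y, False)] \<otimes>\<^bsub>Dih n\<^esub> dih_y n = \<one>\<^bsub>Dih n\<^esub>"
    using pres_cancel[of "dihedral_rels n" Gen_y False]
    by (simp add: Dih_def dih_y_def presented_group_mult presented_group_one word_class_eq_iff)
  moreover have "word_class (dihedral_rels n) [(Gen_y, False)] \<in> carrier (Dih n)"
    by (auto simp: Dih_def presented_group_carrier)
  ultimately have "inv\<^bsub>Dih n\<^esub> dih_y n = word_class (dihedral_rels n) [(Gen_y, False)]"
    using dih_y_closed inv_equality by blast
  moreover have "pres_eq (dihedral_rels n) [(Gen_y, True), (Gen_x, True)] [(Gen_x, True), (Gen_y, False)]"
    by (rule pres_rel) (simp add: dihedral_rels_def)
  ultimately show "dih_y n \<otimes>\<^bsub>Dih n\<^esub> dih_x n = dih_x n \<otimes>\<^bsub>Dih n\<^esub> inv\<^bsub>Dih n\<^esub> dih_y n"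
    by (simp add: Dih_def dih_x_def dih_y_def presented_group_mult word_class_eq_iff)
qed

text \<open>To see that the presentation does not collapse, let the letters act from the left on the
  normal forms \<open>x\<^sup>a y\<^sup>k\<close> with \<open>a\<close> a truth value and \<open>k\<close> a residue modulo \<open>n\<close>.\<close>

fun dih_act :: "nat \<Rightarrow> dihedral_gen \<times> bool \<Rightarrow> bool \<times> int \<Rightarrow> bool \<times> int" where
  "dih_act n (Gen_x, _) (a, k) = (\<not> a, k mod int n)"
| "dih_act n (Gen_y, b) (a, k) = (a, (if a = b then k - 1 else k + 1) mod int n)"

definition dih_nf :: "nat \<Rightarrow> bool \<times> int \<Rightarrow> bool \<times> int" where
  "dih_nf n p = (fst p, snd p mod int n)"

lemma dih_act_nf: "dih_nf n (dih_act n l p) = dih_act n l p" "dih_act n l (dih_nf n p) = dih_act n l p"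
  by (cases l; cases p; cases "fst l"; auto simp: dih_nf_def mod_simps)+

lemma dih_acts_nf: "dih_nf n (foldr (dih_act n) u (dih_nf n p)) = foldr (dih_act n) u (dih_nf n p)"
proof (cases u)
  case Nil
  then show ?thesis by (simp add: dih_nf_def)
next
  case (Cons l u)
  then show ?thesis by (simp add: dih_act_nf)
qed

lemma dih_acts_y:
  "foldr (dih_act n) (replicate m (Gen_y, True)) (dih_nf n (a, k))
    = dih_nf n (a, if a then k - int m else k + int m)"
  by (induction m) (auto simp: dih_nf_def mod_simps algebra_simps)

lemma pres_eq_dih_acts:
  "pres_eq (dihedral_rels n) u v \<Longrightarrow>
    foldr (dih_act n) u (dih_nf n p) = foldr (dih_act n) v (dih_nf n p)"
proof (induction arbitrary: p rule: pres_eq.induct)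
  case (pres_append u u' v v')
  show ?case
    using pres_append.IH(1)[of "foldr (dih_act n) v' (dih_nf n p)"] pres_append.IH(2)[of p]
    by (simp add: dih_acts_nf)
next
  case (pres_cancel g b)
  show ?case by (cases g; cases p; cases b) (auto simp: dih_nf_def mod_simps)
next
  case (pres_rel u v)
  obtain a k where p: "p = (a, k)" by (cases p)
  show ?case
    using pres_rel dih_acts_y[of n n a k] unfolding p dihedral_rels_def
    by (auto simp: dih_nf_def mod_simps)
qed auto

definition dih_elem :: "nat \<Rightarrow> bool \<times> nat \<Rightarrow> dihedral_gen word set" where
  "dih_elem n = (\<lambda>(a, k). word_class (dihedral_rels n)
     ((if a then [(Gen_x, True)] else []) @ replicate k (Gen_y, True)))"

lemma inj_on_dih_elem: "inj_on (dih_elem n) (UNIV \<times> {..<n})"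
proof (rule inj_onI)
  fix p q :: "bool \<times> nat"
  assume p: "p \<in> UNIV \<times> {..<n}" and q: "q \<in> UNIV \<times> {..<n}" and eq: "dih_elem n p = dih_elem n q"
  obtain a k b m where pq: "p = (a, k)" "q = (b, m)" by (cases p; cases q)
  let ?w = "\<lambda>a k. (if a then [(Gen_x, True)] else []) @ replicate k (Gen_y, True)"
  have "foldr (dih_act n) (?w a k) (dih_nf n (False, 0)) = (a, int k)" if "k < n" for a k
    using that dih_acts_y[of n k False 0] by (auto simp: dih_nf_def simp del: foldr_replicate)
  moreover have "pres_eq (dihedral_rels n) (?w a k) (?w b m)"
    using eq by (simp add: pq dih_elem_def word_class_eq_iff)
  ultimately have "(a, int k) = (b, int m)"
    using pres_eq_dih_acts[of n "?w a k" "?w b m" "(False, 0)"] p q pq by auto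
  then show "p = q" by (simp add: pq)
qed

lemma dih_elem_eq:
  "dih_elem n (a, k) = (if a then dih_x n else \<one>\<^bsub>Dih n\<^esub>) \<otimes>\<^bsub>Dih n\<^esub> dih_y n [^]\<^bsub>Dih n\<^esub> k"
  unfolding dih_y_pow
  by (simp add: Dih_def dih_elem_def dih_x_def presented_group_mult presented_group_one)

lemma dih_elem_surj:
  assumes "n \<ge> 1"
  shows "carrier (Dih n) \<subseteq> dih_elem n ` (UNIV \<times> {..<n})"
proof -
  interpret group "Dih n" by (rule group_Dih)
  let ?R = "dihedral_rels n" and ?x = "dih_x n" and ?y = "dih_y n"
  note cl [simp] = dih_x_closed[of n] dih_y_closed[of n]
  note rel = dih_relations[of n]
  have inv_x: "word_class ?R [(Gen_x, False)] = inv\<^bsub>Dih n\<^esub> ?x"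
  proof (rule inv_equality[symmetric])
    show "word_class ?R [(Gen_x, False)] \<otimes>\<^bsub>Dih n\<^esub> ?x = \<one>\<^bsub>Dih n\<^esub>"
      using pres_cancel[of ?R Gen_x False]
      by (simp add: Dih_def dih_x_def presented_group_mult presented_group_one word_class_eq_iff)
  qed (auto simp: Dih_def presented_group_carrier dih_x_def)
  have inv_y: "word_class ?R [(Gen_y, False)] = inv\<^bsub>Dih n\<^esub> ?y"
  proof (rule inv_equality[symmetric])
    show "word_class ?R [(Gen_y, False)] \<otimes>\<^bsub>Dih n\<^esub> ?y = \<one>\<^bsub>Dih n\<^esub>"
      using pres_cancel[of ?R Gen_y False]
      by (simp add: Dih_def dih_y_def presented_group_mult presented_group_one word_class_eq_iff)
  qed (auto simp: Dih_def presented_group_carrier dih_y_def)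
  have x_inv: "inv\<^bsub>Dih n\<^esub> ?x = ?x"
    using rel(1) by (simp add: inv_equality)
  have y_inv: "inv\<^bsub>Dih n\<^esub> ?y = ?y [^]\<^bsub>Dih n\<^esub> (n - 1)"
  proof (rule inv_equality)
    have "?y [^]\<^bsub>Dih n\<^esub> Suc (n - 1) = \<one>\<^bsub>Dih n\<^esub>"
      using rel(2) assms by simp
    then show "?y [^]\<^bsub>Dih n\<^esub> (n - 1) \<otimes>\<^bsub>Dih n\<^esub> ?y = \<one>\<^bsub>Dih n\<^esub>"
      by simp
  qed auto
  have yx: "?y \<otimes>\<^bsub>Dih n\<^esub> ?x = ?x \<otimes>\<^bsub>Dih n\<^esub> ?y [^]\<^bsub>Dih n\<^esub> (n - 1)"
    using rel(3) by (simp add: y_inv)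
  have yix: "inv\<^bsub>Dih n\<^esub> ?y \<otimes>\<^bsub>Dih n\<^esub> ?x = ?x \<otimes>\<^bsub>Dih n\<^esub> ?y [^]\<^bsub>Dih n\<^esub> (1::nat)"
  proof -
    have "?y \<otimes>\<^bsub>Dih n\<^esub> (?x \<otimes>\<^bsub>Dih n\<^esub> ?y) = ?x"
      using rel(3) by (simp flip: m_assoc) (simp add: m_assoc)
    then have "inv\<^bsub>Dih n\<^esub> ?y \<otimes>\<^bsub>Dih n\<^esub> ?x = ?x \<otimes>\<^bsub>Dih n\<^esub> ?y"
      by (metis cl inv_solve_left m_closed)
    then show ?thesis by simp
  qed
  have y_left: "\<exists>m. ?y [^]\<^bsub>Dih n\<^esub> j \<otimes>\<^bsub>Dih n\<^esub> dih_elem n (False, k) = dih_elem n (False, m)" for j k :: nat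
    by (rule exI[of _ "j + k"]) (simp add: dih_elem_eq nat_pow_mult)
  have x_left: "?x \<otimes>\<^bsub>Dih n\<^esub> dih_elem n (a, k) = dih_elem n (\<not> a, k)" for a k
    using rel(1) by (simp add: dih_elem_eq flip: m_assoc)
  have yx_left: "\<exists>m. z \<otimes>\<^bsub>Dih n\<^esub> dih_elem n (True, k) = dih_elem n (True, m)"
    if z: "z \<otimes>\<^bsub>Dih n\<^esub> ?x = ?x \<otimes>\<^bsub>Dih n\<^esub> ?y [^]\<^bsub>Dih n\<^esub> j" "z \<in> carrier (Dih n)" for z k and j :: nat
  proof (rule exI[of _ "j + k"])
    have "z \<otimes>\<^bsub>Dih n\<^esub> (?x \<otimes>\<^bsub>Dih n\<^esub> ?y [^]\<^bsub>Dih n\<^esub> k) = ?x \<otimes>\<^bsub>Dih n\<^esub> ?y [^]\<^bsub>Dih n\<^esub> j \<otimes>\<^bsub>Dih n\<^esub> ?y [^]\<^bsub>Dih n\<^esub> k"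
      using z by (simp flip: m_assoc)
    then show "z \<otimes>\<^bsub>Dih n\<^esub> dih_elem n (True, k) = dih_elem n (True, j + k)"
      by (simp add: dih_elem_eq m_assoc nat_pow_mult)
  qed
  have letter: "\<exists>b m. word_class ?R [l] \<otimes>\<^bsub>Dih n\<^esub> dih_elem n (a, k) = dih_elem n (b, m)" for l a k
  proof -
    obtain g e where l: "l = (g, e)" by (cases l)
    show ?thesis
    proof (cases g)
      case Gen_x
      then have "word_class ?R [l] = ?x"
        using l inv_x x_inv by (cases e) (auto simp: dih_x_def)
      then show ?thesis using x_left by auto
    next
      case Gen_y
      have w: "word_class ?R [l] = ?y [^]\<^bsub>Dih n\<^esub> (if e then 1 else n - 1)"
        using l Gen_y inv_y y_inv by (cases e) (simp_all add: dih_y_def [symmetric])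
      have w': "word_class ?R [l] = (if e then ?y else inv\<^bsub>Dih n\<^esub> ?y)"
        using l Gen_y inv_y by (simp add: dih_y_def)
      show ?thesis
      proof (cases a)
        case False
        then show ?thesis using w y_left by metis
      next
        case True
        then show ?thesis
          using yx_left[OF yx] yx_left[OF yix] cl inv_closed w'
          by metis
      qed
    qed
  qed
  have word: "\<exists>a k. word_class ?R u = dih_elem n (a, k)" for u
  proof (induction u)
    case Nil
    have "word_class ?R [] = dih_elem n (False, 0)" by (simp add: dih_elem_def)
    then show ?case by blast
  next
    case (Cons l u)
    have "word_class ?R (l # u) = word_class ?R [l] \<otimes>\<^bsub>Dih n\<^esub> word_class ?R u"
      by (simp add: Dih_def presented_group_mult)
    then show ?case using Cons.IH letter by metis
  qed
  have "dih_elem n (a, k) = dih_elem n (a, k mod n)" for a k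
  proof -
    have "?y [^]\<^bsub>Dih n\<^esub> k = ?y [^]\<^bsub>Dih n\<^esub> (n * (k div n) + k mod n)"
      by simp
    also have "\<dots> = (?y [^]\<^bsub>Dih n\<^esub> n) [^]\<^bsub>Dih n\<^esub> (k div n) \<otimes>\<^bsub>Dih n\<^esub> ?y [^]\<^bsub>Dih n\<^esub> (k mod n)"
      by (simp only: nat_pow_mult nat_pow_pow cl)
    finally show ?thesis using rel(2) by (simp add: dih_elem_eq)
  qed
  moreover have "k mod n < n" for k using assms by simp
  ultimately have "dih_elem n (a, k) \<in> dih_elem n ` (UNIV \<times> {..<n})" for a k
    by (metis UNIV_I imageI lessThan_iff mem_Sigma_iff)
  then have "word_class ?R u \<in> dih_elem n ` (UNIV \<times> {..<n})" for u
    using word[of u] by auto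
  then show ?thesis
    by (auto simp: Dih_def presented_group_carrier)
qed

lemma bij_betw_dih_elem:
  assumes "n \<ge> 1"
  shows "bij_betw (dih_elem n) (UNIV \<times> {..<n}) (carrier (Dih n))"
proof (rule bij_betw_imageI[OF inj_on_dih_elem])
  show "dih_elem n ` (UNIV \<times> {..<n}) = carrier (Dih n)"
    using dih_elem_surj[OF assms]
    by (auto simp: dih_elem_def Dih_def presented_group_carrier)
qed

lemma order_Dih: "n \<ge> 1 \<Longrightarrow> order (Dih n) = 2 * n"
  using bij_betw_same_card[OF bij_betw_dih_elem, of n]
  by (simp add: order_def card_cartesian_product UNIV_bool)


section \<open>Sequences without product-one subsequences\<close>

text \<open>A list stands for the sequence of its entries; its order is immaterial for the notions
  below, and equality of sequences up to reordering is equality of the multisets of terms.\<close>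

definition list_product :: "('a, 'b) monoid_scheme \<Rightarrow> 'a list \<Rightarrow> 'a" where
  "list_product G gs = foldr (\<otimes>\<^bsub>G\<^esub>) gs \<one>\<^bsub>G\<^esub>"

text \<open>\<open>I\<close> is the index set of the subsequence, and \<open>ns\<close> lists \<open>I\<close> without repetition, in an
  arbitrary order.\<close>

definition product_one_subsequence :: "('a, 'b) monoid_scheme \<Rightarrow> 'a list \<Rightarrow> nat set \<Rightarrow> bool" where
  "product_one_subsequence G S I \<longleftrightarrow>
     I \<noteq> {} \<and> I \<subseteq> {..<length S} \<and>
     (\<exists>ns. distinct ns \<and> set ns = I \<and> list_product G (map (\<lambda>i. S ! i) ns) = \<one>\<^bsub>G\<^esub>)"

definition product_one_free :: "('a, 'b) monoid_scheme \<Rightarrow> 'a list \<Rightarrow> bool" where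
  "product_one_free G S \<longleftrightarrow> \<not> (\<exists>I. product_one_subsequence G S I)"

end

theory Submission
  imports Defs
begin

text \<open>Let \<open>H\<close> be the subgroup of rotations, let \<open>h\<^sub>1, \<dots>, h\<^sub>r\<close> be the rotations of a free
  sequence of length \<open>n\<close> and \<open>a\<^sub>1, \<dots>, a\<^sub>s\<close> its reflections. The \<open>r + 1\<close> prefix products
  \<open>P\<^sub>k = h\<^sub>1 \<cdots> h\<^sub>k\<close> are distinct, and so are the reflections. If \<open>a\<^sub>i P\<^sub>k = a\<^sub>j P\<^sub>l\<close> with
  \<open>k \<le> l\<close> and \<open>i \<noteq> j\<close>, then \<open>a\<^sub>i a\<^sub>j h\<^bsub>k+1\<^esub> \<cdots> h\<^sub>l = a\<^sub>i\<^sup>2 = 1\<close>; hence the \<open>s (r + 1)\<close> products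
  \<open>a\<^sub>i P\<^sub>k\<close> are distinct reflections, so \<open>s (r + 1) \<le> n = r + s\<close>, which forces \<open>r = 0\<close> or
  \<open>s \<le> 1\<close>. Since \<open>r + 1 \<le> n\<close>, the case \<open>s = 0\<close> is impossible. For \<open>s = 1\<close> the prefix products
  exhaust \<open>H\<close> whatever the order of the rotations, so all rotations are equal. For \<open>r = 0\<close> the
  sequence consists of all reflections, and \<open>x \<cdot> x y \<cdot> x y\<^sup>3 \<cdot> x y\<^sup>2 = 1\<close> excludes this if
  \<open>n \<ge> 4\<close>.\<close>

section \<open>Rearrangements and prefix products\<close>

text \<open>Lets all later arguments use lists up to rearrangement in place of index sets. A list
  \<open>L\<close> contained in \<open>S\<close> is completed by some \<open>K\<close> to a
  permutation of \<open>S\<close>, and that permutation supplies distinct positions for the entries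
  of \<open>L\<close>.\<close>

lemma product_one_free_iff_mset:
  "product_one_free G S \<longleftrightarrow>
    (\<forall>L. L \<noteq> [] \<longrightarrow> mset L \<subseteq># mset S \<longrightarrow> list_product G L \<noteq> \<one>\<^bsub>G\<^esub>)"
proof (intro iffI allI impI notI)
  fix L
  assume free: "product_one_free G S" and L: "L \<noteq> []" "mset L \<subseteq># mset S"
    and one: "list_product G L = \<one>\<^bsub>G\<^esub>"
  obtain K where "mset S = mset (L @ K)"
    using L(2) by (metis ex_mset mset_append mset_subset_eq_exists_conv)
  then obtain p where p: "p permutes {..<length S}" "permute_list p S = L @ K"
    by (metis mset_eq_permutation)
  have len: "length L + length K = length S"
    using arg_cong[OF p(2), of length] by simp
  define ns where "ns = map p [0..<length L]"
  have map_ns: "map ((!) S) ns = L"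
  proof (rule nth_equalityI)
    fix i assume "i < length (map ((!) S) ns)"
    then have i: "i < length L" by (simp add: ns_def)
    then have "permute_list p S ! i = S ! p i"
      using permute_list_nth[OF p(1), of i] len by simp
    then show "map ((!) S) ns ! i = L ! i"
      using i p(2) by (simp add: ns_def nth_append)
  qed (simp add: ns_def)
  have "distinct ns"
    using permutes_inj[OF p(1)] by (simp add: ns_def distinct_map inj_on_def)
  moreover have "set ns \<noteq> {}" using L(1) by (simp add: ns_def)
  moreover have "set ns \<subseteq> {..<length S}"
  proof
    fix i assume "i \<in> set ns"
    then obtain j where "i = p j" "j < length L" by (auto simp: ns_def)
    then show "i \<in> {..<length S}"
      using permutes_in_image[OF p(1), of j] len by simp
  qed
  moreover have "list_product G (map ((!) S) ns) = \<one>\<^bsub>G\<^esub>"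
    using one unfolding map_ns .
  ultimately show False
    using free unfolding product_one_free_def product_one_subsequence_def by blast
next
  assume free: "\<forall>L. L \<noteq> [] \<longrightarrow> mset L \<subseteq># mset S \<longrightarrow> list_product G L \<noteq> \<one>\<^bsub>G\<^esub>"
  show "product_one_free G S"
    unfolding product_one_free_def product_one_subsequence_def
  proof (intro notI, elim exE conjE)
    fix I ns
    assume I: "I \<noteq> {}" "I \<subseteq> {..<length S}" "distinct ns" "set ns = I"
      and one: "list_product G (map ((!) S) ns) = \<one>\<^bsub>G\<^esub>"
    \<comment> \<open>Distinct indices occur once each, so reading off entries at them cannot use a
      value more often than \<open>S\<close> has it.\<close>
    have "mset_set (set ns) \<subseteq># mset_set {..<length S}"
      using I by (intro subset_imp_msubset_mset_set) auto
    then have "mset ns \<subseteq># mset_set {0..<length S}"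
      using I(3) by (simp add: mset_set_set lessThan_atLeast0)
    then have "image_mset ((!) S) (mset ns) \<subseteq># image_mset ((!) S) (mset [0..<length S])"
      by (intro image_mset_subseteq_mono) (simp add: mset_upt)
    also have "\<dots> = mset S"
      by (metis map_nth mset_map)
    finally have "mset (map ((!) S) ns) \<subseteq># mset S" by simp
    then show False using free I one by auto
  qed
qed

lemma product_one_free_cong_mset: "mset S = mset T \<Longrightarrow> product_one_free G S = product_one_free G T"
  by (simp add: product_one_free_iff_mset)

lemma product_one_freeD:
  "product_one_free G S \<Longrightarrow> list_product G L = \<one>\<^bsub>G\<^esub> \<Longrightarrow> mset L \<subseteq># mset S \<Longrightarrow> L = []"
  by (auto simp: product_one_free_iff_mset)

lemma product_one_free_subseq: "product_one_free G S \<Longrightarrow> mset T \<subseteq># mset S \<Longrightarrow> product_one_free G T"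
  by (meson product_one_free_iff_mset subset_mset.order_trans)

lemma product_one_free_filter: "product_one_free G S \<Longrightarrow> product_one_free G (filter P S)"
  by (erule product_one_free_subseq) (simp add: multiset_filter_subset)

context monoid
begin

lemma list_product_Nil [simp]: "list_product G [] = \<one>"
  and list_product_Cons [simp]: "list_product G (a # L) = a \<otimes> list_product G L"
  by (simp_all add: list_product_def)

lemma list_product_closed [simp]: "set L \<subseteq> carrier G \<Longrightarrow> list_product G L \<in> carrier G"
  by (induction L) auto

lemma list_product_append:
  "set L \<subseteq> carrier G \<Longrightarrow> set M \<subseteq> carrier G \<Longrightarrow>
    list_product G (L @ M) = list_product G L \<otimes> list_product G M"
  by (induction L) (auto simp: m_assoc)

lemma list_product_replicate:
  assumes "a \<in> carrier G"
  shows "list_product G (replicate k a) = a [^] k"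
proof (induction k)
  case (Suc k)
  then show ?case
    unfolding nat_pow_Suc2[OF assms] by simp
qed simp

lemma list_product_take_split:
  assumes "set L \<subseteq> carrier G" "k \<le> l"
  shows "list_product G (take l L) = list_product G (take k L) \<otimes> list_product G (drop k (take l L))"
proof -
  have "take l L = take k L @ drop k (take l L)"
    using assms(2) append_take_drop_id[of k "take l L"] by (simp add: min_def)
  moreover have "set (take k L) \<subseteq> carrier G" "set (drop k (take l L)) \<subseteq> carrier G"
    using assms(1) by (auto dest!: in_set_dropD in_set_takeD)
  ultimately show ?thesis
    using list_product_append by metis
qed

end

lemma mset_segment: "mset (drop k (take l L)) \<subseteq># mset L"
proof -
  have "mset L = mset (take k (take l L)) + mset (drop k (take l L)) + mset (drop l L)"
    by (metis append_take_drop_id mset_append)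
  then show ?thesis by simp
qed

text \<open>Cancelling the shorter of two equal prefix products would leave the segment between
  them, which is non-empty, with product 1.\<close>

lemma (in group) inj_on_prefix_products:
  assumes L: "set L \<subseteq> carrier G" and free: "product_one_free G L"
  shows "inj_on (\<lambda>k. list_product G (take k L)) {..length L}"
proof (rule linorder_inj_onI)
  fix k l
  assume kl: "k < l" "k \<in> {..length L}" "l \<in> {..length L}"
  let ?M = "drop k (take l L)"
  have M: "set ?M \<subseteq> carrier G"
    using L by (auto dest!: in_set_dropD in_set_takeD)
  have tk: "set (take k L) \<subseteq> carrier G"
    using L by (auto dest: in_set_takeD)
  show "list_product G (take k L) \<noteq> list_product G (take l L)"
  proof
    assume "list_product G (take k L) = list_product G (take l L)"
    then have "list_product G ?M = \<one>"
      using list_product_take_split[OF L, of k l] kl M tk by (simp add: r_cancel_one')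
    then have "?M = []"
      using product_one_freeD[OF free _ mset_segment] by blast
    then show False using kl by simp
  qed
qed auto

section \<open>Generalized dihedral groups\<close>

text \<open>If \<open>a\<close> is outside \<open>H\<close> and \<open>h\<close> is in \<open>H\<close>, then \<open>a\<close> and \<open>a h\<close> are both involutions, so
  \<open>a\<close> inverts \<open>h\<close> by conjugation, as usual in generalized dihedral groups.\<close>

locale generalized_dihedral = group G + subgroup H G for G (structure) and H +
  assumes H_comm: "a \<in> H \<Longrightarrow> b \<in> H \<Longrightarrow> a \<otimes> b = b \<otimes> a"
    and involution: "a \<in> carrier G - H \<Longrightarrow> a \<otimes> a = \<one>"
    and outside_mult: "a \<in> carrier G - H \<Longrightarrow> b \<in> carrier G - H \<Longrightarrow> a \<otimes> b \<in> H"
    and finite_carrier: "finite (carrier G)"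
begin

lemma list_product_in_H: "set L \<subseteq> H \<Longrightarrow> list_product G L \<in> H"
  by (induction L) auto

lemma prefix_product_in_H: "set L \<subseteq> H \<Longrightarrow> list_product G (take k L) \<in> H"
  by (rule list_product_in_H) (auto dest: in_set_takeD)

lemma outside_mult_H:
  assumes "a \<in> carrier G - H" "h \<in> H"
  shows "a \<otimes> h \<in> carrier G - H" "h \<otimes> a \<in> carrier G - H"
proof -
  have "a \<otimes> h \<notin> H"
  proof
    assume "a \<otimes> h \<in> H"
    then have "a \<otimes> h \<otimes> inv h \<in> H" using assms(2) by blast
    then show False using assms by (simp add: m_assoc)
  qed
  moreover have "h \<otimes> a \<notin> H"
  proof
    assume "h \<otimes> a \<in> H"
    then have "inv h \<otimes> (h \<otimes> a) \<in> H" using assms(2) by blast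
    then show False using assms by (simp flip: m_assoc)
  qed
  ultimately show "a \<otimes> h \<in> carrier G - H" "h \<otimes> a \<in> carrier G - H"
    using assms by auto
qed

text \<open>Each factor outside \<open>H\<close> switches sides, as for a subgroup of index two, so
  only the parity of their number matters. This is what later proves sequences free.\<close>

lemma list_product_in_H_iff:
  "set L \<subseteq> carrier G \<Longrightarrow> list_product G L \<in> H \<longleftrightarrow> even (length (filter (\<lambda>a. a \<notin> H) L))"
proof (induction L)
  case (Cons a L)
  then have "list_product G L \<in> carrier G" by simp
  with Cons show ?case
    using outside_mult_H[of a "list_product G L"] outside_mult_H[of "list_product G L" a]
      outside_mult[of a "list_product G L"] by auto
qed simp

section \<open>Counting products of outside terms with prefix products\<close>

lemma free_outside_distinct:
  assumes "set S \<subseteq> carrier G" "product_one_free G S"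
  shows "distinct (filter (\<lambda>a. a \<notin> H) S)"
proof (rule ccontr)
  let ?F = "filter (\<lambda>a. a \<notin> H) S"
  assume "\<not> distinct ?F"
  then obtain xs ys zs a where F: "?F = xs @ [a] @ ys @ [a] @ zs"
    using not_distinct_decomp by blast
  then have "a \<in> set ?F" by simp
  then have "a \<in> carrier G - H" using assms(1) by auto
  then have "list_product G [a, a] = \<one>" using involution by simp
  moreover have "mset [a, a] \<subseteq># mset ?F" unfolding F by simp
  ultimately show False
    using product_one_freeD[OF product_one_free_filter[OF assms(2)]] by blast
qed

lemma free_outside_prefix_ineq:
  assumes S: "set S \<subseteq> carrier G" and free: "product_one_free G S"
  defines "F \<equiv> filter (\<lambda>a. a \<notin> H) S" and "L \<equiv> filter (\<lambda>a. a \<in> H) S"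
  assumes ab: "a \<in> set F" "b \<in> set F" "a \<noteq> b" and kl: "k \<le> l"
  shows "a \<otimes> list_product G (take k L) \<noteq> b \<otimes> list_product G (take l L)"
proof
  assume eq: "a \<otimes> list_product G (take k L) = b \<otimes> list_product G (take l L)"
  let ?M = "drop k (take l L)"
  define p q where "p = list_product G (take k L)" and "q = list_product G ?M"
  have L: "set L \<subseteq> H" by (auto simp: L_def)
  have cl: "p \<in> H" "q \<in> H"
    unfolding p_def q_def using prefix_product_in_H[OF L]
    by (auto intro!: list_product_in_H dest!: in_set_dropD in_set_takeD intro: subsetD[OF L])
  have ab': "a \<in> carrier G - H" "b \<in> carrier G - H"
    using ab S by (auto simp: F_def)
  have "set L \<subseteq> carrier G" using L by auto
  then have "a \<otimes> p = b \<otimes> (p \<otimes> q)"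
    using eq kl list_product_take_split[of L k l] by (simp add: p_def q_def)
  \<comment> \<open>Commutativity of \<open>H\<close> moves the common prefix \<open>p\<close> to
    the right end, where it cancels.\<close>
  then have "a \<otimes> p = b \<otimes> q \<otimes> p"
    using ab' cl H_comm[of p q] by (simp add: m_assoc)
  then have "a = b \<otimes> q" using ab' cl by simp
  then have "list_product G (a # b # ?M) = \<one>"
    using involution[OF ab'(1)] by (simp add: q_def)
  moreover have "mset (a # b # ?M) \<subseteq># mset S"
  proof -
    \<comment> \<open>Since \<open>a \<noteq> b\<close>, they are two separate terms of
      \<open>S\<close>; the segment \<open>?M\<close> is drawn from the remaining terms, those in
      \<open>H\<close>.\<close>
    have "mset_set {a, b} \<subseteq># mset_set (set F)"
      using ab by (intro subset_imp_msubset_mset_set) auto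
    also have "\<dots> \<subseteq># mset F" by (rule mset_set_set_mset_msubset[of "mset F", simplified])
    finally have "{#a, b#} \<subseteq># mset F" using ab(3) by simp
    then have "{#a, b#} + mset ?M \<subseteq># mset F + mset L"
      using mset_segment by (rule subset_mset.add_mono)
    also have "mset F + mset L = mset S"
      unfolding F_def L_def by (induction S) auto
    finally show ?thesis by simp
  qed
  ultimately show False using product_one_freeD[OF free] by blast
qed

text \<open>The pairs \<open>(a, k)\<close> index pairwise different elements outside
  \<open>H\<close>; the factor \<open>length L + 1\<close> includes the empty prefix
  \<open>k = 0\<close>.\<close>

lemma free_count_bound:
  assumes S: "set S \<subseteq> carrier G" and free: "product_one_free G S"
  defines "F \<equiv> filter (\<lambda>a. a \<notin> H) S" and "L \<equiv> filter (\<lambda>a. a \<in> H) S"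
  shows "length F * (length L + 1) \<le> card (carrier G - H)"
proof -
  let ?P = "\<lambda>k. list_product G (take k L)"
  have L: "set L \<subseteq> H" by (auto simp: L_def)
  have P: "?P k \<in> H" for k
    using L by (rule prefix_product_in_H)
  have F: "set F \<subseteq> carrier G - H" using S by (auto simp: F_def)
  have inj: "inj_on (\<lambda>(a, k). a \<otimes> ?P k) (set F \<times> {..length L})"
  proof (rule inj_onI, clarify)
    fix a b k l
    assume ab: "a \<in> set F" "b \<in> set F" and kl: "k \<le> length L" "l \<le> length L"
      and eq: "a \<otimes> ?P k = b \<otimes> ?P l"
    \<comment> \<open>The inequality is available only for \<open>k \<le> l\<close>, so it is used
      in both orders.\<close>
    have "a = b"
      using free_outside_prefix_ineq[OF S free, of a b k l]
        free_outside_prefix_ineq[OF S free, of b a l k] ab eq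
      unfolding F_def L_def by (metis nat_le_linear)
    then have "?P k = ?P l" using eq ab F P by (auto simp: subset_iff)
    moreover have "product_one_free G L"
      unfolding L_def using free by (rule product_one_free_filter)
    moreover have "set L \<subseteq> carrier G" using L subset by blast
    ultimately have "k = l"
      using inj_onD[OF inj_on_prefix_products, of L k l] kl by simp
    with \<open>a = b\<close> show "a = b \<and> k = l" by simp
  qed
  have "(\<lambda>(a, k). a \<otimes> ?P k) ` (set F \<times> {..length L}) \<subseteq> carrier G - H"
  proof
    fix z assume "z \<in> (\<lambda>(a, k). a \<otimes> ?P k) ` (set F \<times> {..length L})"
    then obtain a k where "a \<in> set F" "z = a \<otimes> ?P k" by auto
    then show "z \<in> carrier G - H"
      using outside_mult_H(1)[of a "?P k"] F P[of k] by blast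
  qed
  then have "card (set F \<times> {..length L}) \<le> card (carrier G - H)"
    using inj finite_carrier by (metis card_inj_on_le finite_Diff)
  moreover have "distinct F"
    unfolding F_def using S free by (rule free_outside_distinct)
  ultimately show ?thesis by (simp add: card_cartesian_product distinct_card)
qed

section \<open>Long free sequences inside \<open>H\<close>\<close>

lemma free_length_less_card:
  assumes "set L \<subseteq> H" "product_one_free G L"
  shows "length L < card H"
proof -
  have "(\<lambda>k. list_product G (take k L)) ` {..length L} \<subseteq> H"
    using prefix_product_in_H[OF assms(1)] by blast
  moreover have "inj_on (\<lambda>k. list_product G (take k L)) {..length L}"
    using assms by (intro inj_on_prefix_products) auto
  \<comment> \<open>The empty prefix counts too, so there are \<open>length L + 1\<close> different
    prefix products and the bound is strict.\<close>
  ultimately have "card {..length L} \<le> card H"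
    by (metis card_inj_on_le finite_carrier finite_subset subset)
  then show ?thesis by simp
qed

text \<open>The prefix products of \<open>a, b, \<dots>\<close> exhaust \<open>H\<close>, but \<open>b\<close> is not among them if \<open>a \<noteq> b\<close>.\<close>

lemma free_maximal_first_two_eq:
  assumes L: "set (a # b # L) \<subseteq> H" and free: "product_one_free G (a # b # L)"
    and len: "length L + 3 = card H"
  shows "a = b"
proof (rule ccontr)
  assume "a \<noteq> b"
  let ?P = "\<lambda>k. list_product G (take k (a # b # L))"
  have inj: "inj_on ?P {..length (a # b # L)}"
    using L free by (intro inj_on_prefix_products) auto
  have PH: "?P k \<in> H" for k
    using L by (rule prefix_product_in_H)
  \<comment> \<open>The prefix lengths run from \<open>0\<close> to \<open>length L + 2\<close>, so
    there are \<open>card H\<close> of them and the injection into \<open>H\<close> is onto.\<close>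
  have "?P ` {..length (a # b # L)} = H"
  proof (rule card_subset_eq)
    show "finite H" using finite_carrier finite_subset subset by blast
    show "card (?P ` {..length (a # b # L)}) = card H"
      using card_image[OF inj] len by simp
  qed (use PH in blast)
  moreover have "b \<in> H" using L by simp
  ultimately obtain k where k: "b = ?P k" by auto
  \<comment> \<open>So \<open>b\<close> is 1, or \<open>a\<close>, or a longer prefix product
    \<open>a b q\<close>; each possibility contradicts freeness or
    \<open>a \<noteq> b\<close>.\<close>
  consider "k = 0" | "k = 1" | m where "k = Suc (Suc m)"
    by (metis One_nat_def not0_implies_Suc)
  then show False
  proof cases
    case 1
    then have "list_product G [b] = \<one>" using k by simp
    moreover have "mset [b] \<subseteq># mset (a # b # L)" by simp
    ultimately show False using product_one_freeD[OF free] by blast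
  next
    case 2
    then show False using k \<open>a \<noteq> b\<close> L by simp
  next
    case 3
    define q where "q = list_product G (take m L)"
    have M: "set (take m L) \<subseteq> H" using L set_take_subset[of m L] by auto
    then have q: "q \<in> H" unfolding q_def by (rule list_product_in_H)
    have "b = a \<otimes> (b \<otimes> q)" using k 3 by (simp add: q_def)
    \<comment> \<open>Since \<open>b\<close> is itself a factor, it commutes to the front and
      cancels, leaving the product-one list \<open>a # take m L\<close>.\<close>
    also have "\<dots> = b \<otimes> (a \<otimes> q)"
      using L q H_comm[of a b] by (simp flip: m_assoc)
    finally have "a \<otimes> q = \<one>" using L q by (simp add: r_cancel_one')
    then have "list_product G (a # take m L) = \<one>" by (simp add: q_def)
    moreover have "mset (a # take m L) \<subseteq># mset (a # b # L)"
    proof -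
      have "mset (take m L) \<subseteq># mset L" using mset_segment[of 0 m L] by simp
      also have "\<dots> \<subseteq># add_mset b (mset L)"
        by (metis add_mset_add_single mset_subset_eq_add_left)
      finally show ?thesis by simp
    qed
    ultimately show False using product_one_freeD[OF free] by blast
  qed
qed

text \<open>Freeness ignores order, so any two different entries may be moved to the front, where
  \<open>free_maximal_first_two_eq\<close> applies.\<close>

lemma free_maximal_constant:
  assumes L: "set L \<subseteq> H" and free: "product_one_free G L" and len: "length L + 1 = card H"
    and ab: "a \<in> set L" "b \<in> set L"
  shows "a = b"
proof (rule ccontr)
  assume "a \<noteq> b"
  let ?L = "remove1 b (remove1 a L)"
  have m: "mset (a # b # ?L) = mset L"
  proof -
    have "b \<in> set (remove1 a L)" using ab \<open>a \<noteq> b\<close> by simp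
    then have "mset (b # ?L) = mset (remove1 a L)"
      by (simp only: mset.simps mset_remove1[of b]) (simp only: insert_DiffM set_mset_mset)
    then show ?thesis using ab(1) by simp
  qed
  have "length (a # b # ?L) = length L" "set (a # b # ?L) = set L"
    using m mset_eq_length mset_eq_setD by blast+
  then have "length ?L + 3 = card H" "set (a # b # ?L) \<subseteq> H"
    using len L by simp_all
  moreover have "product_one_free G (a # b # ?L)"
    using free m product_one_free_cong_mset by blast
  ultimately show False
    using free_maximal_first_two_eq \<open>a \<noteq> b\<close> by blast
qed

text \<open>The trichotomy is by the number of terms outside \<open>H\<close>. With none, the
  sequence would be free inside \<open>H\<close> and of length \<open>card H\<close>, which is too
  long, so only two cases survive.\<close>

lemma free_order_trichotomy:
  assumes S: "set S \<subseteq> carrier G" and free: "product_one_free G S"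
    and len: "length S = card H" and outside: "card (carrier G - H) = card H"
  obtains (one_outside) a b where "a \<in> H" "b \<in> carrier G - H"
      "mset S = mset (replicate (card H - 1) a @ [b])"
    | (all_outside) "mset S = mset_set (carrier G - H)"
proof -
  let ?F = "filter (\<lambda>a. a \<notin> H) S" and ?L = "filter (\<lambda>a. a \<in> H) S"
  have F: "set ?F \<subseteq> carrier G - H" using S by auto
  have msets: "mset S = mset ?L + mset ?F" by (induction S) auto
  then have sum: "length ?L + length ?F = card H"
    using len by (metis size_mset size_union)
  have freeL: "product_one_free G ?L" using free by (rule product_one_free_filter)
  have L: "set ?L \<subseteq> H" by auto
  have "length ?F * (length ?L + 1) \<le> length ?L + length ?F"
    using free_count_bound[OF S free] outside sum by simp
  \<comment> \<open>Here \<open>length ?F\<close> cancels from both sides of the bound; the explicit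
    factor 1 prepares the cancellation of \<open>length ?L\<close>.\<close>
  then have "length ?F * length ?L \<le> 1 * length ?L" by simp
  then have "length ?L = 0 \<or> length ?F \<le> 1" by (simp only: mult_le_cancel2) auto
  moreover have "length ?F \<noteq> 0" using free_length_less_card[OF L freeL] sum by linarith
  ultimately consider "length ?L = 0" | "length ?F = 1" by linarith
  then show thesis
  proof cases
    case 1
    have d: "distinct ?F" using S free by (rule free_outside_distinct)
    have "set ?F = carrier G - H"
    proof (rule card_subset_eq)
      show "card (set ?F) = card (carrier G - H)"
        using distinct_card[OF d] 1 sum outside by linarith
    qed (use F finite_carrier in auto)
    moreover have "mset S = mset ?F"
      using msets 1 by (simp only: length_0_conv mset.simps add_0)
    ultimately have "mset S = mset_set (carrier G - H)"
      using mset_set_set[OF d] by simp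
    then show thesis by (rule all_outside)
  next
    case 2
    then obtain b where b: "?F = [b]" by (metis One_nat_def length_0_conv length_Suc_conv)
    have lenL: "length ?L + 1 = card H" using 2 sum by simp
    obtain a where a: "a \<in> H" "\<forall>c \<in> set ?L. c = a"
    proof (cases "?L = []")
      \<comment> \<open>Here \<open>card H = 1\<close>, so \<open>a\<close> is repeated zero times
        and any element of \<open>H\<close> will do.\<close>
      case True
      then show thesis using that[of \<one>] by simp
    next
      case False
      then show thesis
        using that[of "hd ?L"] free_maximal_constant[OF L freeL lenL _ hd_in_set[OF False]]
          hd_in_set[OF False] L by blast
    qed
    then have "?L = replicate (card H - 1) a"
      using lenL by (metis add_diff_cancel_right' replicate_eqI)
    then have "mset S = mset (replicate (card H - 1) a @ [b])"
      using msets b by simp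
    moreover have "b \<in> carrier G - H" using F b by simp
    ultimately show thesis using a one_outside by blast
  qed
qed

end

section \<open>Rotations and reflections\<close>

text \<open>Natural exponents are enough for a subgroup when \<open>n \<ge> 1\<close>, because
  \<open>y\<close> then has finite order and its inverse is a natural power.\<close>

definition dih_rotations :: "nat \<Rightarrow> dihedral_gen word set set" where
  "dih_rotations n = range (\<lambda>k::nat. dih_y n [^]\<^bsub>Dih n\<^esub> k)"

context
  fixes n :: nat and G and x y
  assumes n: "n \<ge> 1"
  defines "G \<equiv> Dih n" and "x \<equiv> dih_x n" and "y \<equiv> dih_y n"
begin

interpretation group G
  unfolding G_def by (rule group_Dih)

section \<open>Powers of \<open>y\<close> and normal forms\<close>

lemma dih_closed [simp]: "x \<in> carrier G" "y \<in> carrier G"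
  by (simp_all add: G_def x_def y_def dih_x_closed dih_y_closed)

lemma dih_elem_G: "dih_elem n (a, k) = (if a then x else \<one>\<^bsub>G\<^esub>) \<otimes>\<^bsub>G\<^esub> y [^]\<^bsub>G\<^esub> k"
  unfolding G_def x_def y_def by (rule dih_elem_eq)

lemma dih_rotations_iff: "a \<in> dih_rotations n \<longleftrightarrow> (\<exists>k::nat. a = y [^]\<^bsub>G\<^esub> k)"
  by (auto simp: dih_rotations_def G_def y_def)

lemma dih_y_pow_n: "y [^]\<^bsub>G\<^esub> n = \<one>\<^bsub>G\<^esub>"
  unfolding G_def y_def by (rule dih_relations)

lemma dih_y_pow_mod: "y [^]\<^bsub>G\<^esub> k = y [^]\<^bsub>G\<^esub> (k mod n)" for k :: nat
proof -
  have "y [^]\<^bsub>G\<^esub> k = y [^]\<^bsub>G\<^esub> (n * (k div n) + k mod n)" by simp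
  also have "\<dots> = (y [^]\<^bsub>G\<^esub> n) [^]\<^bsub>G\<^esub> (k div n) \<otimes>\<^bsub>G\<^esub> y [^]\<^bsub>G\<^esub> (k mod n)"
    by (simp only: nat_pow_mult nat_pow_pow dih_closed)
  finally show ?thesis by (simp add: dih_y_pow_n)
qed

text \<open>The relations only bound the order of \<open>y\<close> from above; uniqueness of the
  normal form, \<open>inj_on_dih_elem\<close>, shows that it is exactly \<open>n\<close>.\<close>

lemma dih_y_pow_eq_iff: "y [^]\<^bsub>G\<^esub> k = y [^]\<^bsub>G\<^esub> l \<longleftrightarrow> k mod n = l mod n" for k l :: nat
proof
  assume "y [^]\<^bsub>G\<^esub> k = y [^]\<^bsub>G\<^esub> l"
  then have "dih_elem n (False, k mod n) = dih_elem n (False, l mod n)"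
    using dih_y_pow_mod by (simp add: dih_elem_G)
  then show "k mod n = l mod n"
    using inj_onD[OF inj_on_dih_elem[of n], of "(False, k mod n)" "(False, l mod n)"] n by auto
qed (metis dih_y_pow_mod)

lemma dih_y_pow_eq_one_iff: "y [^]\<^bsub>G\<^esub> k = \<one>\<^bsub>G\<^esub> \<longleftrightarrow> n dvd k" for k :: nat
  using dih_y_pow_eq_iff[of k 0] by (auto simp: dvd_eq_mod_eq_0)

lemma dih_reflection_notin_rotations: "x \<otimes>\<^bsub>G\<^esub> y [^]\<^bsub>G\<^esub> k \<notin> dih_rotations n" for k :: nat
proof
  assume "x \<otimes>\<^bsub>G\<^esub> y [^]\<^bsub>G\<^esub> k \<in> dih_rotations n"
  then obtain l :: nat where "x \<otimes>\<^bsub>G\<^esub> y [^]\<^bsub>G\<^esub> k = y [^]\<^bsub>G\<^esub> l"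
    by (auto simp: dih_rotations_def G_def y_def)
  then have "dih_elem n (True, k mod n) = dih_elem n (False, l mod n)"
    using dih_y_pow_mod by (simp add: dih_elem_G)
  then show False
    using inj_onD[OF inj_on_dih_elem[of n], of "(True, k mod n)" "(False, l mod n)"] n by auto
qed

text \<open>An inverse-free form of \<open>y x = x y^-1\<close>. In the induction the innermost
  \<open>y x y\<close> collapses to \<open>x\<close>.\<close>

lemma dih_y_pow_conj: "y [^]\<^bsub>G\<^esub> k \<otimes>\<^bsub>G\<^esub> (x \<otimes>\<^bsub>G\<^esub> y [^]\<^bsub>G\<^esub> k) = x" for k :: nat
proof (induction k)
  case (Suc k)
  have rel: "y \<otimes>\<^bsub>G\<^esub> (x \<otimes>\<^bsub>G\<^esub> y) = x"
    using dih_relations(3)[of n] by (simp add: G_def [symmetric] x_def [symmetric] y_def [symmetric] flip: m_assoc)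
      (simp add: m_assoc)
  have "y [^]\<^bsub>G\<^esub> Suc k \<otimes>\<^bsub>G\<^esub> (x \<otimes>\<^bsub>G\<^esub> y [^]\<^bsub>G\<^esub> Suc k)
      = y [^]\<^bsub>G\<^esub> k \<otimes>\<^bsub>G\<^esub> y \<otimes>\<^bsub>G\<^esub> (x \<otimes>\<^bsub>G\<^esub> (y \<otimes>\<^bsub>G\<^esub> y [^]\<^bsub>G\<^esub> k))"
    by (metis dih_closed(2) nat_pow_Suc nat_pow_Suc2)
  also have "\<dots> = y [^]\<^bsub>G\<^esub> k \<otimes>\<^bsub>G\<^esub> (y \<otimes>\<^bsub>G\<^esub> (x \<otimes>\<^bsub>G\<^esub> y) \<otimes>\<^bsub>G\<^esub> y [^]\<^bsub>G\<^esub> k)"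
    by (simp add: m_assoc)
  also have "\<dots> = x" using Suc rel by simp
  finally show ?case .
qed simp

lemma dih_x_square: "x \<otimes>\<^bsub>G\<^esub> x = \<one>\<^bsub>G\<^esub>"
  unfolding G_def x_def by (rule dih_relations)

lemma dih_carrier_diff_rotations:
  "carrier G - dih_rotations n = (\<lambda>k. x \<otimes>\<^bsub>G\<^esub> y [^]\<^bsub>G\<^esub> k) ` {..<n}"
proof
  show "carrier G - dih_rotations n \<subseteq> (\<lambda>k. x \<otimes>\<^bsub>G\<^esub> y [^]\<^bsub>G\<^esub> k) ` {..<n}"
  proof
    fix g assume g: "g \<in> carrier G - dih_rotations n"
    then obtain a k where ak: "g = dih_elem n (a, k)" "k < n"
      using dih_elem_surj[OF n] by (auto simp: G_def)
    have "a"
      using g ak by (cases a) (auto simp: dih_elem_G dih_rotations_iff)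
    then show "g \<in> (\<lambda>k. x \<otimes>\<^bsub>G\<^esub> y [^]\<^bsub>G\<^esub> k) ` {..<n}"
      using ak by (auto simp: dih_elem_G)
  qed
qed (use dih_reflection_notin_rotations in auto)

lemma dih_rotations_eq: "dih_rotations n = (\<lambda>k. y [^]\<^bsub>G\<^esub> k) ` {..<n}"
proof (intro subset_antisym subsetI)
  fix a assume "a \<in> dih_rotations n"
  then obtain k :: nat where "a = y [^]\<^bsub>G\<^esub> (k mod n)"
    using dih_rotations_iff dih_y_pow_mod by metis
  moreover have "k mod n < n" using n by simp
  ultimately show "a \<in> (\<lambda>k. y [^]\<^bsub>G\<^esub> k) ` {..<n}" by blast
qed (use dih_rotations_iff in blast)

lemma card_dih_rotations: "card (dih_rotations n) = n"
proof -
  have "inj_on (\<lambda>k::nat. y [^]\<^bsub>G\<^esub> k) {..<n}"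
    by (rule inj_onI) (simp add: dih_y_pow_eq_iff)
  then show ?thesis by (simp add: dih_rotations_eq card_image)
qed

lemma inj_on_dih_reflections: "inj_on (\<lambda>k. x \<otimes>\<^bsub>G\<^esub> y [^]\<^bsub>G\<^esub> k) {..<n}"
  by (rule inj_onI) (simp add: dih_y_pow_eq_iff)

lemma card_dih_reflections: "card (carrier G - dih_rotations n) = n"
  by (simp add: dih_carrier_diff_rotations card_image inj_on_dih_reflections)

lemma generalized_dihedral_Dih: "generalized_dihedral G (dih_rotations n)"
proof -
  have refl: "\<exists>k::nat. a = x \<otimes>\<^bsub>G\<^esub> y [^]\<^bsub>G\<^esub> k" if "a \<in> carrier G - dih_rotations n" for a
    using that unfolding dih_carrier_diff_rotations by auto
  have invol: "(x \<otimes>\<^bsub>G\<^esub> y [^]\<^bsub>G\<^esub> k) \<otimes>\<^bsub>G\<^esub> (x \<otimes>\<^bsub>G\<^esub> y [^]\<^bsub>G\<^esub> k) = \<one>\<^bsub>G\<^esub>" for k :: nat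
    using dih_y_pow_conj[of k] dih_x_square by (simp add: m_assoc)
  \<comment> \<open>The exponent \<open>k * (n - 1)\<close> represents \<open>-k\<close> modulo
    \<open>n\<close>.\<close>
  have inv_rot: "inv\<^bsub>G\<^esub> (y [^]\<^bsub>G\<^esub> k) = y [^]\<^bsub>G\<^esub> (k * (n - 1))" for k :: nat
  proof (rule inv_equality)
    have "k * (n - 1) + k = k * n" using n by (cases n) auto
    then show "y [^]\<^bsub>G\<^esub> (k * (n - 1)) \<otimes>\<^bsub>G\<^esub> y [^]\<^bsub>G\<^esub> k = \<one>\<^bsub>G\<^esub>"
      by (simp add: nat_pow_mult dih_y_pow_eq_one_iff)
  qed auto
  have sub: "subgroup (dih_rotations n) G"
  proof (rule subgroupI)
    show "dih_rotations n \<subseteq> carrier G"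
      by (auto simp: dih_rotations_iff)
    show "dih_rotations n \<noteq> {}"
      by (simp add: dih_rotations_def)
    show "inv\<^bsub>G\<^esub> a \<in> dih_rotations n" if "a \<in> dih_rotations n" for a
      using that inv_rot by (auto simp: dih_rotations_iff)
    show "a \<otimes>\<^bsub>G\<^esub> b \<in> dih_rotations n" if "a \<in> dih_rotations n" "b \<in> dih_rotations n" for a b
      using that by (auto simp: dih_rotations_iff nat_pow_mult)
  qed
  show ?thesis
  proof (intro generalized_dihedral.intro generalized_dihedral_axioms.intro sub)
    show "group G" by (rule group_axioms)
    show "a \<otimes>\<^bsub>G\<^esub> b = b \<otimes>\<^bsub>G\<^esub> a" if "a \<in> dih_rotations n" "b \<in> dih_rotations n" for a b
      using that by (auto simp: dih_rotations_iff nat_pow_mult add.commute)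
    show "a \<otimes>\<^bsub>G\<^esub> a = \<one>\<^bsub>G\<^esub>" if "a \<in> carrier G - dih_rotations n" for a
      using refl[OF that] invol by auto
    show "a \<otimes>\<^bsub>G\<^esub> b \<in> dih_rotations n"
      if a: "a \<in> carrier G - dih_rotations n" and b: "b \<in> carrier G - dih_rotations n" for a b
    proof -
      obtain k l :: nat where ab: "a = x \<otimes>\<^bsub>G\<^esub> y [^]\<^bsub>G\<^esub> k" "b = x \<otimes>\<^bsub>G\<^esub> y [^]\<^bsub>G\<^esub> l"
        using refl[OF a] refl[OF b] by auto
      \<comment> \<open>As \<open>a\<close> is an involution, \<open>a x\<close> is inverse to
        \<open>y^k\<close>; hence \<open>a b = y^-k y^l\<close>, a rotation.\<close>
      have "a \<otimes>\<^bsub>G\<^esub> x \<otimes>\<^bsub>G\<^esub> y [^]\<^bsub>G\<^esub> k = \<one>\<^bsub>G\<^esub>"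
        using invol[of k] by (simp add: ab m_assoc)
      then have "a \<otimes>\<^bsub>G\<^esub> x = inv\<^bsub>G\<^esub> (y [^]\<^bsub>G\<^esub> k)"
        by (metis a b ab(1) DiffD1 dih_closed inv_equality inv_inv m_closed nat_pow_closed)
      then have "a \<otimes>\<^bsub>G\<^esub> b = inv\<^bsub>G\<^esub> (y [^]\<^bsub>G\<^esub> k) \<otimes>\<^bsub>G\<^esub> y [^]\<^bsub>G\<^esub> l"
        using a by (simp add: ab(2) flip: m_assoc)
      then show ?thesis by (auto simp: dih_rotations_iff inv_rot nat_pow_mult)
    qed
    show "finite (carrier G)"
      using bij_betw_finite[OF bij_betw_dih_elem[OF n]] by (simp add: G_def)
  qed
qed

section \<open>Free and non-free sequences in the dihedral group\<close>

lemma dih_four_reflections_product: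
  "list_product G [x, x \<otimes>\<^bsub>G\<^esub> y, x \<otimes>\<^bsub>G\<^esub> y [^]\<^bsub>G\<^esub> (3::nat), x \<otimes>\<^bsub>G\<^esub> y [^]\<^bsub>G\<^esub> (2::nat)] = \<one>\<^bsub>G\<^esub>"
proof -
  have 3: "y [^]\<^bsub>G\<^esub> (3::nat) = y \<otimes>\<^bsub>G\<^esub> y [^]\<^bsub>G\<^esub> (2::nat)"
    by (simp add: numeral_3_eq_3 numeral_2_eq_2 m_assoc)
  \<comment> \<open>The first two terms multiply to \<open>y\<close> and the last two to
    \<open>y^-1\<close>; the computation gets there through \<open>dih_y_pow_conj\<close> with
    exponents 2 and 1.\<close>
  have "y [^]\<^bsub>G\<^esub> (3::nat) \<otimes>\<^bsub>G\<^esub> (x \<otimes>\<^bsub>G\<^esub> y [^]\<^bsub>G\<^esub> (2::nat)) = y \<otimes>\<^bsub>G\<^esub> x"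
    using dih_y_pow_conj[of 2] unfolding 3 by (simp add: m_assoc)
  moreover have "y \<otimes>\<^bsub>G\<^esub> (x \<otimes>\<^bsub>G\<^esub> (y \<otimes>\<^bsub>G\<^esub> x)) = \<one>\<^bsub>G\<^esub>"
    using arg_cong[OF dih_y_pow_conj[of 1], of "\<lambda>g. g \<otimes>\<^bsub>G\<^esub> x"] dih_x_square by (simp add: m_assoc)
  ultimately have "x \<otimes>\<^bsub>G\<^esub> (x \<otimes>\<^bsub>G\<^esub> (y \<otimes>\<^bsub>G\<^esub> (x \<otimes>\<^bsub>G\<^esub> (y [^]\<^bsub>G\<^esub> (3::nat) \<otimes>\<^bsub>G\<^esub> (x \<otimes>\<^bsub>G\<^esub> y [^]\<^bsub>G\<^esub> (2::nat)))))) = \<one>\<^bsub>G\<^esub>"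
    by (simp add: dih_x_square)
  then show ?thesis by (simp add: m_assoc)
qed

text \<open>A product equal to 1 is a rotation, so by parity it uses an even number of reflections,
  hence none. It is then a power of \<open>y^t\<close> with positive exponent below
  \<open>n\<close>, impossible for \<open>t\<close> coprime to \<open>n\<close>.\<close>

lemma dih_one_reflection_free:
  fixes t s :: nat
  assumes "gcd t n = 1"
  shows "product_one_free G (replicate (n - 1) (y [^]\<^bsub>G\<^esub> t) @ [x \<otimes>\<^bsub>G\<^esub> y [^]\<^bsub>G\<^esub> s])"
  unfolding product_one_free_iff_mset
proof (intro allI impI notI)
  interpret generalized_dihedral G "dih_rotations n" by (rule generalized_dihedral_Dih)
  let ?h = "y [^]\<^bsub>G\<^esub> t" and ?r = "x \<otimes>\<^bsub>G\<^esub> y [^]\<^bsub>G\<^esub> s"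
  fix L
  assume L: "L \<noteq> []" and sub: "mset L \<subseteq># mset (replicate (n - 1) ?h @ [?r])"
    and one: "list_product G L = \<one>\<^bsub>G\<^esub>"
  have h: "?h \<in> dih_rotations n" by (auto simp: dih_rotations_def G_def y_def)
  have set: "set L \<subseteq> {?h, ?r}"
  proof -
    have "set L \<subseteq> set (replicate (n - 1) ?h @ [?r])"
      using set_mset_mono[OF sub] by (simp only: set_mset_mset)
    also have "\<dots> \<subseteq> {?h, ?r}" by (simp add: set_replicate_conv_if)
    finally show ?thesis .
  qed
  then have carrier: "set L \<subseteq> carrier G" by (rule order_trans) simp
  have "even (length (filter (\<lambda>a. a \<notin> dih_rotations n) L))"
    using list_product_in_H_iff[OF carrier] one by simp
  moreover have "length (filter (\<lambda>a. a \<notin> dih_rotations n) L) \<le> 1"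
  proof -
    have "size (filter_mset (\<lambda>a. a \<notin> dih_rotations n) (mset L))
        \<le> size (filter_mset (\<lambda>a. a \<notin> dih_rotations n) (mset (replicate (n - 1) ?h @ [?r])))"
      using sub by (intro size_mset_mono multiset_filter_mono)
    also have "\<dots> = length (filter (\<lambda>a. a \<notin> dih_rotations n) [?r])"
      using h by (simp only: mset_filter [symmetric] size_mset filter_append filter_replicate) simp
    also have "\<dots> \<le> 1" by simp
    finally show ?thesis by (simp flip: mset_filter)
  qed
  ultimately have "filter (\<lambda>a. a \<notin> dih_rotations n) L = []"
    by (cases "filter (\<lambda>a. a \<notin> dih_rotations n) L") auto
  then have "set L \<subseteq> {?h}"
    using set dih_reflection_notin_rotations unfolding filter_empty_conv by blast
  then have Lrep: "L = replicate (length L) ?h" by (intro replicate_eqI refl) blast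
  have "n dvd t * length L"
    using one list_product_replicate[of ?h "length L"]
    by (metis Lrep dih_closed(2) dih_y_pow_eq_one_iff nat_pow_closed nat_pow_pow)
  then have "n dvd length L"
    using assms by (metis coprime_dvd_mult_right_iff coprime_iff_gcd_eq_1 coprime_commute)
  moreover have "length L < n"
  proof -
    \<comment> \<open>The reflection must not add to the count of \<open>?h\<close>; otherwise
      \<open>n\<close> copies would be available.\<close>
    have "?h \<noteq> ?r" using h dih_reflection_notin_rotations by metis
    have "mset L = replicate_mset (length L) ?h" by (metis Lrep mset_replicate)
    then have "length L = count (mset L) ?h" by (metis count_replicate_mset)
    also have "\<dots> \<le> n - 1"
      using mset_subset_eq_count[OF sub, of ?h] \<open>?h \<noteq> ?r\<close> by simp
    finally show ?thesis using n by simp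
  qed
  ultimately show False using L by (simp add: nat_dvd_not_less)
qed

text \<open>If \<open>d = gcd t n\<close> exceeded 1, then \<open>n / d\<close> copies of
  \<open>y^t\<close> would already multiply to 1, and that many are present since
  \<open>n / d \<le> n - 1\<close>.\<close>

lemma dih_constant_rotations_free_coprime:
  fixes t :: nat
  assumes "product_one_free G (replicate (n - 1) (y [^]\<^bsub>G\<^esub> t))"
  shows "gcd t n = 1"
proof (rule ccontr)
  assume g: "gcd t n \<noteq> 1"
  define k where "k = n div gcd t n"
  have gn: "gcd t n * k = n" by (simp add: k_def)
  have "gcd t n > 1" using g n by (metis gcd_eq_0_iff less_one linorder_neqE_nat not_one_le_zero)
  have "k > 0" using gn n by (auto intro: Nat.gr0I)
  then have "1 * k < gcd t n * k"
    using \<open>gcd t n > 1\<close> by (simp only: mult_less_cancel2 simp_thms)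
  with \<open>k > 0\<close> have k: "0 < k" "k \<le> n - 1" using gn by simp_all
  have "n dvd t * k" by (metis gn gcd_dvd1 mult_dvd_mono dvd_refl)
  then have "list_product G (replicate k (y [^]\<^bsub>G\<^esub> t)) = \<one>\<^bsub>G\<^esub>"
    by (simp add: list_product_replicate nat_pow_pow dih_y_pow_eq_one_iff)
  moreover have "mset (replicate k (y [^]\<^bsub>G\<^esub> t)) \<subseteq># mset (replicate (n - 1) (y [^]\<^bsub>G\<^esub> t))"
    using k by (simp add: subseteq_mset_def)
  ultimately have "replicate k (y [^]\<^bsub>G\<^esub> t) = []" using product_one_freeD[OF assms] by blast
  then show False using k by simp
qed

lemma dih_free_cases:
  assumes S: "set S \<subseteq> carrier G" "length S = n" and free: "product_one_free G S" and n2: "n \<ge> 2"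
  obtains (one_reflection) t s :: nat where "1 \<le> t" "t \<le> n - 1" "gcd t n = 1" "s \<le> n - 1"
      "mset S = mset (replicate (n - 1) (y [^]\<^bsub>G\<^esub> t) @ [x \<otimes>\<^bsub>G\<^esub> y [^]\<^bsub>G\<^esub> s])"
    | (reflections) "mset S = image_mset (\<lambda>k. x \<otimes>\<^bsub>G\<^esub> y [^]\<^bsub>G\<^esub> k) (mset_set {..<n})"
proof -
  interpret generalized_dihedral G "dih_rotations n" by (rule generalized_dihedral_Dih)
  have "length S = card (dih_rotations n)" by (simp add: S card_dih_rotations)
  moreover have "card (carrier G - dih_rotations n) = card (dih_rotations n)"
    by (simp add: card_dih_rotations card_dih_reflections)
  ultimately show thesis
  proof (cases rule: free_order_trichotomy[OF S(1) free, consumes 2])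
    case (1 a b)
    obtain t where t: "a = y [^]\<^bsub>G\<^esub> t" "t < n" using 1(1) by (auto simp: dih_rotations_eq)
    obtain s where s: "b = x \<otimes>\<^bsub>G\<^esub> y [^]\<^bsub>G\<^esub> s" "s < n"
      using 1(2) unfolding dih_carrier_diff_rotations by auto
    have m: "mset S = mset (replicate (n - 1) (y [^]\<^bsub>G\<^esub> t) @ [x \<otimes>\<^bsub>G\<^esub> y [^]\<^bsub>G\<^esub> s])"
      using 1(3) t s by (simp add: card_dih_rotations)
    have "product_one_free G (replicate (n - 1) (y [^]\<^bsub>G\<^esub> t))"
      using free by (rule product_one_free_subseq) (simp add: m)
    then have g: "gcd t n = 1" by (rule dih_constant_rotations_free_coprime)
    \<comment> \<open>For \<open>t = 0\<close> the gcd is \<open>n\<close>, which is not 1 since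
      \<open>n \<ge> 2\<close>.\<close>
    have "t \<noteq> 0"
    proof
      assume "t = 0"
      then show False using g n2 by simp
    qed
    then show thesis using g t s m by (intro one_reflection[of t s]) auto
  next
    case 2
    then have "mset S = image_mset (\<lambda>k. x \<otimes>\<^bsub>G\<^esub> y [^]\<^bsub>G\<^esub> k) (mset_set {..<n})"
      using image_mset_mset_set[OF inj_on_dih_reflections]
      by (simp add: dih_carrier_diff_rotations)
    then show thesis by (rule reflections)
  qed
qed

lemma dih_all_reflections_not_free:
  assumes "n \<ge> 4" and m: "mset S = image_mset (\<lambda>k. x \<otimes>\<^bsub>G\<^esub> y [^]\<^bsub>G\<^esub> k) (mset_set {..<n})"
  shows "\<not> product_one_free G S"
proof
  assume free: "product_one_free G S"
  \<comment> \<open>By \<open>n \<ge> 4\<close> the numbers 0 to 3 are exponents below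
    \<open>n\<close>, so the four reflections with product 1 all occur in \<open>S\<close>.\<close>
  have "mset_set {0, 1, 2, 3} \<subseteq># mset_set {..<n}"
    using assms(1) by (intro subset_imp_msubset_mset_set) auto
  then have "image_mset (\<lambda>k. x \<otimes>\<^bsub>G\<^esub> y [^]\<^bsub>G\<^esub> k) (mset_set {0, 1, 2, 3::nat}) \<subseteq># mset S"
    unfolding m by (rule image_mset_subseteq_mono)
  then have "mset [x, x \<otimes>\<^bsub>G\<^esub> y, x \<otimes>\<^bsub>G\<^esub> y [^]\<^bsub>G\<^esub> (3::nat), x \<otimes>\<^bsub>G\<^esub> y [^]\<^bsub>G\<^esub> (2::nat)] \<subseteq># mset S"
    by (simp add: add_mset_commute)
  then show False
    using product_one_freeD[OF free dih_four_reflections_product] by simp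
qed

text \<open>Parity leaves only subsequences of length two, and two reflections multiply to 1 only
  when equal, which distinctness forbids. This settles the exceptional sequence for
  \<open>n = 3\<close>.\<close>

lemma dih_three_reflections_free:
  assumes "distinct S" "set S \<subseteq> carrier G - dih_rotations n" "length S \<le> 3"
  shows "product_one_free G S"
  unfolding product_one_free_iff_mset
proof (intro allI impI notI)
  interpret generalized_dihedral G "dih_rotations n" by (rule generalized_dihedral_Dih)
  fix L
  assume L: "L \<noteq> []" and sub: "mset L \<subseteq># mset S" and one: "list_product G L = \<one>\<^bsub>G\<^esub>"
  have out: "set L \<subseteq> carrier G - dih_rotations n"
    using set_mset_mono[OF sub] assms(2) by auto
  have "length L \<le> 3" using size_mset_mono[OF sub] assms(3) by simp
  moreover have "even (length L)"
  proof -
    have "filter (\<lambda>a. a \<notin> dih_rotations n) L = L" using out by (auto simp: filter_id_conv)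
    then show ?thesis using list_product_in_H_iff[of L] out one by auto
  qed
  ultimately have "length L = 2" using L by (cases L) (auto simp: le_Suc_eq numeral_3_eq_3)
  then obtain a b where ab: "L = [a, b]"
    by (metis (no_types, lifting) One_nat_def Suc_1 length_0_conv length_Suc_conv)
  \<comment> \<open>\<open>b\<close> is an involution, so \<open>a b = b b\<close> and
    \<open>b\<close> cancels.\<close>
  have "a = b"
    using one involution[of b] out by (simp add: ab) (metis r_cancel)
  then have "count (mset L) a = 2" by (simp add: ab)
  moreover have "count (mset S) a \<le> 1" using assms(1) by (simp add: distinct_count_atmost_1)
  ultimately show False using mset_subset_eq_count[OF sub, of a] by simp
qed

end

section \<open>Assembly of the two equivalences\<close>

theorem theorem1p3:
  fixes n :: nat and S :: "dihedral_gen word set list"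
  assumes "n \<ge> 3"
    and "set S \<subseteq> carrier (Dih n)"
    and "length S = n"
  shows "(n \<ge> 4 \<longrightarrow>
      (product_one_free (Dih n) S \<longleftrightarrow>
        (\<exists>t s :: nat. 1 \<le> t \<and> t \<le> n - 1 \<and> gcd t n = 1 \<and> 0 \<le> s \<and> s \<le> n - 1 \<and>
          mset S = mset (replicate (n - 1) (dih_y n [^]\<^bsub>Dih n\<^esub> t) @
            [dih_x n \<otimes>\<^bsub>Dih n\<^esub> dih_y n [^]\<^bsub>Dih n\<^esub> s])))) \<and>
    (n = 3 \<longrightarrow>
      (product_one_free (Dih n) S \<longleftrightarrow>
        ((\<exists>t \<in> {1, 2 :: nat}. \<exists>\<nu> \<in> {0, 1, 2 :: nat}.
          mset S = mset [dih_y n [^]\<^bsub>Dih n\<^esub> t, dih_y n [^]\<^bsub>Dih n\<^esub> t,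
            dih_x n \<otimes>\<^bsub>Dih n\<^esub> dih_y n [^]\<^bsub>Dih n\<^esub> \<nu>]) \<or>
         mset S = mset [dih_x n, dih_x n \<otimes>\<^bsub>Dih n\<^esub> dih_y n,
          dih_x n \<otimes>\<^bsub>Dih n\<^esub> dih_y n [^]\<^bsub>Dih n\<^esub> (2 :: nat)])))"
    (is "(_ \<longrightarrow> (?free \<longleftrightarrow> ?one)) \<and> (_ \<longrightarrow> (_ \<longleftrightarrow> ?two \<or> ?refl))")
proof (intro conjI impI)
  have n1: "n \<ge> 1" and n2: "n \<ge> 2" using assms(1) by simp_all
  interpret group "Dih n" by (rule group_Dih)
  \<comment> \<open>Valid for every \<open>n \<ge> 3\<close>, so it serves both parts; for
    \<open>n = 3\<close> the form \<open>?two\<close> is converted to \<open>?one\<close>.\<close>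
  have one_free: ?free if ?one
  proof -
    from that obtain t s :: nat where "gcd t n = 1"
      and m: "mset S = mset (replicate (n - 1) (dih_y n [^]\<^bsub>Dih n\<^esub> t) @
        [dih_x n \<otimes>\<^bsub>Dih n\<^esub> dih_y n [^]\<^bsub>Dih n\<^esub> s])"
      by (elim exE conjE)
    then show ?thesis
      using dih_one_reflection_free[OF n1, of t s] by (simp only: product_one_free_cong_mset[OF m])
  qed
  note cases = dih_free_cases[OF n1 assms(2,3) _ n2]
  {
    assume n4: "n \<ge> 4"
    have ?one if free: ?free
    proof (cases rule: cases[OF free])
      case (1 t s)
      then show ?thesis by (intro exI[of _ t] exI[of _ s]) simp
    next
      case 2
      then show ?thesis using dih_all_reflections_not_free[OF n1 n4] free by blast
    qed
    then show "?free \<longleftrightarrow> ?one" using one_free by (rule iffI)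
  }
  assume n3: "n = 3"
  have list3: "replicate (n - 1) a @ [b] = [a, a, b]" for a b :: "dihedral_gen word set"
    by (simp add: n3 numeral_2_eq_2)
  \<comment> \<open>For \<open>n = 3\<close> this identifies the sequence of all reflections with
    the explicit list in \<open>?refl\<close>.\<close>
  have image3: "image_mset f (mset_set {..<n}) = mset [f 0, f 1, f 2]" for f :: "nat \<Rightarrow> dihedral_gen word set"
  proof -
    have "{..<n} = {0, 1, 2}" using n3 by auto
    then show ?thesis by simp
  qed
  show "?free \<longleftrightarrow> ?two \<or> ?refl"
  proof
    assume free: ?free
    show "?two \<or> ?refl"
    proof (cases rule: cases[OF free])
      case (1 t s)
      then have "t \<in> {1, 2}" "s \<in> {0, 1, 2}" using n3 by auto
      moreover note 1(5)[unfolded list3]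
      ultimately show ?thesis by (intro disjI1 bexI[of _ t] bexI[of _ s])
    next
      case 2
      then show ?thesis unfolding image3 by (simp add: dih_x_closed dih_y_closed)
    qed
  next
    assume "?two \<or> ?refl"
    then show ?free
    proof
      assume ?two
      then obtain t \<nu> :: nat where t: "t \<in> {1, 2}" "\<nu> \<in> {0, 1, 2}"
        and m: "mset S = mset [dih_y n [^]\<^bsub>Dih n\<^esub> t, dih_y n [^]\<^bsub>Dih n\<^esub> t,
            dih_x n \<otimes>\<^bsub>Dih n\<^esub> dih_y n [^]\<^bsub>Dih n\<^esub> \<nu>]"
        by blast
      \<comment> \<open>Consecutive numbers are coprime, which covers \<open>t = 2\<close> with
        \<open>n = 3\<close>.\<close>
      have "gcd t n = 1"
        using t(1) n3 coprime_Suc_right_nat[of 2] by (auto simp: coprime_iff_gcd_eq_1)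
      moreover have "1 \<le> t" "t \<le> n - 1" "\<nu> \<le> n - 1" using t n3 by auto
      ultimately have ?one
        using m by (intro exI[of _ t] exI[of _ \<nu>]) (simp only: list3 simp_thms le0)
      then show ?free by (rule one_free)
    next
      let ?f = "\<lambda>k::nat. dih_x n \<otimes>\<^bsub>Dih n\<^esub> dih_y n [^]\<^bsub>Dih n\<^esub> k"
      assume ?refl
      then have m: "mset S = image_mset ?f (mset_set {..<n})"
        unfolding image3 by (simp add: dih_x_closed dih_y_closed)
      have S: "mset S = mset_set (carrier (Dih n) - dih_rotations n)"
        unfolding m dih_carrier_diff_rotations[OF n1]
        by (rule image_mset_mset_set[OF inj_on_dih_reflections[OF n1]])
      have fin: "finite (carrier (Dih n) - dih_rotations n)"
        by (simp add: dih_carrier_diff_rotations[OF n1])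
      have "set S = carrier (Dih n) - dih_rotations n"
        using arg_cong[OF S, of set_mset] fin by simp
      \<comment> \<open>There are \<open>n\<close> reflections and \<open>n\<close> terms in
        \<open>S\<close>, so no term repeats.\<close>
      moreover from this have "distinct S"
        using card_dih_reflections[OF n1] assms(3) by (intro card_distinct) simp
      ultimately show ?free
        using dih_three_reflections_free[OF n1] assms(3) n3 by simp
    qed
  qed
qed

end
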